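(* Let $P\in \mathrm{Sc}(q+1)$ be a scale group such that the standard labelling of $T_{q+1}$ is compatible with $P$. For each vertex $\mathbf{v}$ of $T_{q+1}$ put $P|_{\mathbf{v}} = \{x|_{\mathbf{v}} \mid x\in P\}\subseteq \mathrm{Isom}(T_{q,q})$. Then $P|_{\mathbf{v}}$ is independent of the vertex $\mathbf{v}$, is equal to $\{\phi_{\mathbf{v}}\circ g|_{T_{\mathbf{v}}}\circ\phi_{\mathbf{v}}^{-1} \mid g\in P_{\mathbf{v}}\}$ (where here $g|_{T_{\mathbf v}}$ is the ordinary restriction of $g$ to the subtree $T_{\mathbf v}$), and is a closed self-replicating subgroup of $\mathrm{Isom}(T_{q,q})$.
   Context: Let $q\ge 2$ be an integer. For a tree $T$, $\mathrm{Isom}(T)$ is its automorphism group (for a rooted tree, automorphisms fix the root), with the topology of pointwise convergence on vertices; $G_{\mathbf v}$ denotes the stabiliser of a vertex $\mathbf v$. An end of a tree is an equivalence class of rays, two rays being equivalent if they share infinitely many vertices. The regular tree $T_{q+1}$ is the following graph. For $n\in\mathbb{Z}$, $\mathcal{V}_n$ is the set of strings $\mathbf{w}=(w_i)_{i\le n}$ with $w_i\in\{0,\dots,q-1\}$ and $w_i=0$ for all but finitely many $i$. The vertex set is $\bigcup_{n\in\mathbb Z}\mathcal{V}_n$. For $\mathbf{w}\in\mathcal{V}_n$, $\mathbf{w}^+\in\mathcal{V}_{n-1}$ is obtained by deleting the last term, and for $j\in\{0,\dots,q-1\}$, $\mathbf{w}j\in\mathcal{V}_{n+1}$ is obtained by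 appending $j$. The edges are the pairs $\{\mathbf{w},\mathbf{w}^+\}$. Every ray $\mathbf w,\mathbf w^+,\mathbf w^{++},\dots$ belongs to one and the same end, denoted $\omega$. For a vertex $\mathbf{v}$, $T_{\mathbf v}$ is the component containing $\mathbf v$ of the graph obtained by deleting the edge $\{\mathbf v,\mathbf v^+\}$, i.e. it is spanned by all strings extending $\mathbf v$ by finitely many further symbols. A scale group is a closed subgroup of $\mathrm{Isom}(T_{q+1})$ that fixes $\omega$ and is transitive on vertices; $\mathrm{Sc}(q+1)$ is the set of scale groups. The standard labelling assigns to each directed edge a label: $c_{\mathbf v}(\mathbf v,\mathbf v j)=j$ for $j\in\{0,\dots,q-1\}$ and $c_{\mathbf v}(\mathbf v,\mathbf v^+)=q$. It is compatible with $P$ if for all vertices $\mathbf u_1,\mathbf u_2$ there is $x\in P$ with $x.\mathbf u_1=\mathbf u_2$ such that $c_{x.\mathbf a}(x.\mathbf a,x.\mathbf b)=c_{\mathbf a}(\mathbf a,\mathbf b)$ for every directed edge $(\mathbf a,\mathbf b)$ of $T_{\mathbf u_1}$. (The other two requirements for a compatible labelling, that edges towards $\omega$ are labelled $q$ and that there is a bi-infinite path $(\mathbf v_n)$ with $\mathbf v_n=\mathbf v_{n+1}^+$ all of whose edges $(\mathbf v_n,\mathbf v_{n+1})$ are labelled $0$, hold automatically for the standard labelling.) $T_{q,q}$ is the rooted tree whose vertices are the finite strings in $\{0,\dots,q-1\}$, with root the empty string and with each $\mathbf w$ having the children $\mathbf wj$, $j\in\{0,\dots,q-1\}$; level $n$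 is the set of strings of length $n$. For $\mathbf v$ a vertex of $T_{q+1}$, $\phi_{\mathbf v}:T_{\mathbf v}\to T_{q,q}$ is the isomorphism $\mathbf v v_{n+1}\dots v_m\mapsto v_{n+1}\dots v_m$. For $g\in\mathrm{Isom}(T_{q+1})$ fixing $\omega$, the section of $g$ at $\mathbf v$ is $g|_{\mathbf v}=\phi_{g.\mathbf v}\circ g\circ\phi_{\mathbf v}^{-1}\in\mathrm{Isom}(T_{q,q})$. For $g\in\mathrm{Isom}(T_{q,q})$ and a vertex $\mathbf w$ of $T_{q,q}$, the section $g|_{\mathbf w}\in\mathrm{Isom}(T_{q,q})$ is defined by $g.(\mathbf w\mathbf u)=(g.\mathbf w)(g|_{\mathbf w}.\mathbf u)$ for all finite strings $\mathbf u$. A subgroup $G\le\mathrm{Isom}(T_{q,q})$ is self-similar if $g|_{\mathbf w}\in G$ for all $g\in G$ and all vertices $\mathbf w$. A self-similar $G$ is self-replicating if it is transitive on level $1$ and for every vertex $\mathbf w$ the map $g\mapsto g|_{\mathbf w}$, $G_{\mathbf w}\to G$, is surjective. *)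

theory Defs
  imports "HOL-Analysis.Analysis" "HOL-Algebra.Bij"
begin

section \<open>Automorphism groups of graphs\<close>

text \<open>
  A graph is given by its vertex set \<open>V\<close> and a set \<open>E\<close> of two-element edges. Automorphisms
  are elements of \<^term>\<open>Bij V\<close>, i.e. bijections of \<open>V\<close> that are \<open>undefined\<close> off \<open>V\<close>; thus
  equality of functions is equality on \<open>V\<close>.
\<close>

definition isom :: "'a set \<Rightarrow> 'a set set \<Rightarrow> ('a \<Rightarrow> 'a) set" where
  "isom V E = {g \<in> Bij V. \<forall>a\<in>V. \<forall>b\<in>V. {g a, g b} \<in> E \<longleftrightarrow> {a, b} \<in> E}"

definition rooted_isom :: "'a set \<Rightarrow> 'a set set \<Rightarrow> 'a \<Rightarrow> ('a \<Rightarrow> 'a) set" where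
  "rooted_isom V E r = {g \<in> isom V E. g r = r}"

definition perm_group :: "'a set \<Rightarrow> ('a \<Rightarrow> 'a) set \<Rightarrow> ('a \<Rightarrow> 'a) monoid" where
  "perm_group V A = (BijGroup V)\<lparr>carrier := A\<rparr>"

text \<open>The topology of pointwise convergence on the (discrete) set \<open>V\<close>.\<close>

definition pointwise_topology :: "'a set \<Rightarrow> ('a \<Rightarrow> 'a) set \<Rightarrow> ('a \<Rightarrow> 'a) topology" where
  "pointwise_topology V A = subtopology (product_topology (\<lambda>_. discrete_topology V) V) A"

definition closed_subgroup :: "'a set \<Rightarrow> ('a \<Rightarrow> 'a) set \<Rightarrow> ('a \<Rightarrow> 'a) set \<Rightarrow> bool" where
  "closed_subgroup V A H \<longleftrightarrow>
     subgroup H (perm_group V A) \<and> closedin (pointwise_topology V A) H"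

definition vertex_stabiliser :: "('a \<Rightarrow> 'a) set \<Rightarrow> 'a \<Rightarrow> ('a \<Rightarrow> 'a) set" where
  "vertex_stabiliser H v = {g \<in> H. g v = v}"

definition transitive_on :: "('a \<Rightarrow> 'a) set \<Rightarrow> 'a set \<Rightarrow> bool" where
  "transitive_on H S \<longleftrightarrow> (\<forall>u\<in>S. \<forall>v\<in>S. \<exists>g\<in>H. g u = v)"

lemma group_isom: "group (perm_group V (isom V E))"
proof -
  have "subgroup (isom V E) (BijGroup V)"
  proof (rule group.subgroupI[OF group_BijGroup])
    show "isom V E \<subseteq> carrier (BijGroup V)"
      by (auto simp: isom_def BijGroup_def)
    have "(\<lambda>x\<in>V. x) \<in> isom V E"
      by (auto simp: isom_def id_Bij)
    then show "isom V E \<noteq> {}" by blast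
  next
    fix g assume g: "g \<in> isom V E"
    then have gB: "g \<in> Bij V" by (auto simp: isom_def)
    have bij: "bij_betw g V V" using gB by (auto simp: Bij_def)
    have "restrict (inv_into V g) V \<in> isom V E"
      unfolding isom_def
    proof (intro CollectI conjI ballI)
      show "restrict (inv_into V g) V \<in> Bij V" using gB by (rule restrict_inv_into_Bij)
      fix a b assume ab: "a \<in> V" "b \<in> V"
      have iv: "inv_into V g a \<in> V" "inv_into V g b \<in> V"
        using bij ab by (auto simp: bij_betw_def inv_into_into)
      have "{g (inv_into V g a), g (inv_into V g b)} \<in> E \<longleftrightarrow> {inv_into V g a, inv_into V g b} \<in> E"
        using g iv by (auto simp: isom_def)
      moreover have "g (inv_into V g a) = a" "g (inv_into V g b) = b"
        using bij ab by (auto simp: bij_betw_def f_inv_into_f)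
      ultimately show "{restrict (inv_into V g) V a, restrict (inv_into V g) V b} \<in> E \<longleftrightarrow> {a, b} \<in> E"
        using ab by simp
    qed
    then show "inv\<^bsub>BijGroup V\<^esub> g \<in> isom V E"
      using gB by (simp add: inv_BijGroup)
  next
    fix g h assume gh: "g \<in> isom V E" "h \<in> isom V E"
    then have B: "g \<in> Bij V" "h \<in> Bij V" by (auto simp: isom_def)
    have "compose V g h \<in> isom V E"
      using gh B compose_Bij[OF B] Bij_imp_funcset[OF B(2)]
      by (auto simp: isom_def compose_def Pi_iff)
    then show "g \<otimes>\<^bsub>BijGroup V\<^esub> h \<in> isom V E"
      using B by (simp add: BijGroup_def)
  qed
  then show ?thesis
    unfolding perm_group_def by (rule subgroup.subgroup_is_group[OF _ group_BijGroup])
qed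


section \<open>The regular tree with a distinguished end\<close>

text \<open>
  The string \<open>(w\<^sub>i)\<^bsub>i \<le> n\<^esub>\<close> is the partial function with domain \<open>{..n}\<close>; in particular
  strings that differ by trailing zeros are different vertices.
\<close>

type_synonym vertex = "int \<Rightarrow> nat option"

definition vertices_at :: "nat \<Rightarrow> int \<Rightarrow> vertex set" where
  "vertices_at q n =
     {w. dom w = {..n} \<and> ran w \<subseteq> {..<q} \<and> finite {i. i \<le> n \<and> w i \<noteq> Some 0}}"

definition vertices :: "nat \<Rightarrow> vertex set" where
  "vertices q = (\<Union>n. vertices_at q n)"

definition vlevel :: "vertex \<Rightarrow> int" where
  "vlevel w = (THE n. dom w = {..n})"

definition parent :: "vertex \<Rightarrow> vertex" where
  "parent w = w(vlevel w := None)"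

definition child :: "vertex \<Rightarrow> nat \<Rightarrow> vertex" where
  "child w j = w(vlevel w + 1 \<mapsto> j)"

definition edges :: "nat \<Rightarrow> vertex set set" where
  "edges q = {{w, parent w} | w. w \<in> vertices q}"

abbreviation Isom_tree :: "nat \<Rightarrow> (vertex \<Rightarrow> vertex) set" where
  "Isom_tree q \<equiv> isom (vertices q) (edges q)"

definition rays :: "nat \<Rightarrow> (nat \<Rightarrow> vertex) set" where
  "rays q = {r. range r \<subseteq> vertices q \<and> inj r \<and> (\<forall>n. {r n, r (Suc n)} \<in> edges q)}"

definition ray_equiv :: "nat \<Rightarrow> ((nat \<Rightarrow> vertex) \<times> (nat \<Rightarrow> vertex)) set" where
  "ray_equiv q = {(r, s). r \<in> rays q \<and> s \<in> rays q \<and> infinite (range r \<inter> range s)}"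

definition ancestor_ray :: "vertex \<Rightarrow> nat \<Rightarrow> vertex" where
  "ancestor_ray w n = (parent ^^ n) w"

text \<open>
  The end of the ancestor ray of the all-zero string of level 0; the choice of the starting
  vertex is immaterial, see \<open>ancestor_ray_in_omega\<close> below.
\<close>

definition omega :: "nat \<Rightarrow> (nat \<Rightarrow> vertex) set" where
  "omega q = ray_equiv q `` {ancestor_ray (\<lambda>i. if i \<le> 0 then Some 0 else None)}"

definition fixes_omega :: "nat \<Rightarrow> (vertex \<Rightarrow> vertex) \<Rightarrow> bool" where
  "fixes_omega q g \<longleftrightarrow> (\<lambda>r. g \<circ> r) ` omega q = omega q"

text \<open>The component of \<open>v\<close> after deletion of the edge from \<open>v\<close> to \<^term>\<open>parent v\<close>.\<close>

definition subtree :: "nat \<Rightarrow> vertex \<Rightarrow> vertex set" where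
  "subtree q v = {u. (v, u) \<in> {(a, b). {a, b} \<in> edges q - {{v, parent v}}}\<^sup>*}"

definition scale_groups :: "nat \<Rightarrow> (vertex \<Rightarrow> vertex) set set" where
  "scale_groups q = {P. closed_subgroup (vertices q) (Isom_tree q) P \<and>
     (\<forall>g\<in>P. fixes_omega q g) \<and> transitive_on P (vertices q)}"

text \<open>
  The standard label of the directed edge from \<open>a\<close> to \<open>b\<close>: \<open>q\<close> towards the distinguished
  end, otherwise the last symbol of \<open>b\<close>.
\<close>

definition std_label :: "nat \<Rightarrow> vertex \<Rightarrow> vertex \<Rightarrow> nat" where
  "std_label q a b = (if b = parent a then q else the (b (vlevel b)))"

definition std_labelling_compatible :: "nat \<Rightarrow> (vertex \<Rightarrow> vertex) set \<Rightarrow> bool" where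
  "std_labelling_compatible q P \<longleftrightarrow>
     (\<forall>u\<^sub>1\<in>vertices q. \<forall>u\<^sub>2\<in>vertices q. \<exists>x\<in>P. x u\<^sub>1 = u\<^sub>2 \<and>
        (\<forall>a\<in>subtree q u\<^sub>1. \<forall>b\<in>subtree q u\<^sub>1. {a, b} \<in> edges q \<longrightarrow>
           std_label q (x a) (x b) = std_label q a b))"


section \<open>The rooted tree\<close>

definition words :: "nat \<Rightarrow> nat list set" where
  "words q = lists {..<q}"

definition word_edges :: "nat \<Rightarrow> nat list set set" where
  "word_edges q = {{w, w @ [j]} | w j. w \<in> words q \<and> j < q}"

abbreviation Isom_words :: "nat \<Rightarrow> (nat list \<Rightarrow> nat list) set" where
  "Isom_words q \<equiv> rooted_isom (words q) (word_edges q) []"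

text \<open>
  The section \<open>h\<close> of \<open>g\<close> at \<open>w\<close> is determined by \<open>g (w @ u) = g w @ h u\<close>,
  see \<open>word_section_eq\<close> below.
\<close>

definition word_section :: "nat \<Rightarrow> (nat list \<Rightarrow> nat list) \<Rightarrow> nat list \<Rightarrow> nat list \<Rightarrow> nat list" where
  "word_section q g w = (\<lambda>u\<in>words q. drop (length (g w)) (g (w @ u)))"

definition self_similar :: "nat \<Rightarrow> (nat list \<Rightarrow> nat list) set \<Rightarrow> bool" where
  "self_similar q G \<longleftrightarrow> subgroup G (perm_group (words q) (Isom_words q)) \<and>
     (\<forall>g\<in>G. \<forall>w\<in>words q. word_section q g w \<in> G)"

definition self_replicating :: "nat \<Rightarrow> (nat list \<Rightarrow> nat list) set \<Rightarrow> bool" where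
  "self_replicating q G \<longleftrightarrow> self_similar q G \<and>
     transitive_on G {w \<in> words q. length w = 1} \<and>
     (\<forall>w\<in>words q. (\<lambda>g. word_section q g w) ` vertex_stabiliser G w = G)"


section \<open>Sections of automorphisms of the regular tree\<close>

text \<open>\<open>phi v\<close> deletes the prefix \<open>v\<close> of a string extending \<open>v\<close>.\<close>

definition phi :: "vertex \<Rightarrow> vertex \<Rightarrow> nat list" where
  "phi v u = map (\<lambda>i. the (u i)) [vlevel v + 1..vlevel u]"

definition phi_inv :: "nat \<Rightarrow> vertex \<Rightarrow> nat list \<Rightarrow> vertex" where
  "phi_inv q v = inv_into (subtree q v) (phi v)"

definition tree_section :: "nat \<Rightarrow> (vertex \<Rightarrow> vertex) \<Rightarrow> vertex \<Rightarrow> nat list \<Rightarrow> nat list" where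
  "tree_section q g v = restrict (phi (g v) \<circ> g \<circ> phi_inv q v) (words q)"

definition group_sections :: "nat \<Rightarrow> (vertex \<Rightarrow> vertex) set \<Rightarrow> vertex \<Rightarrow> (nat list \<Rightarrow> nat list) set" where
  "group_sections q P v = {tree_section q x v | x. x \<in> P}"


section \<open>Basic facts\<close>

lemma vlevel_eq: "dom w = {..n} \<Longrightarrow> vlevel w = n"
  by (auto simp: vlevel_def)

lemma verticesE:
  assumes "w \<in> vertices q"
  shows "dom w = {..vlevel w}" "w \<in> vertices_at q (vlevel w)"
  using assms vlevel_eq by (auto simp: vertices_def vertices_at_def)

lemma child_at:
  assumes "w \<in> vertices_at q n" "j < q"
  shows "child w j \<in> vertices_at q (n + 1)"
proof -
  have d: "dom w = {..n}" and f: "finite {i. i \<le> n \<and> w i \<noteq> Some 0}" and r: "ran w \<subseteq> {..<q}"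
    using assms by (auto simp: vertices_at_def)
  have l: "vlevel w = n" using d by (rule vlevel_eq)
  have "finite {i. i \<le> n + 1 \<and> child w j i \<noteq> Some 0}"
    by (rule finite_subset[OF _ finite.insertI[OF f, of "n + 1"]]) (auto simp: child_def l)
  moreover have "dom (child w j) = {..n + 1}"
    using d by (auto simp: child_def l)
  moreover have "ran (child w j) \<subseteq> {..<q}"
    using r assms(2) by (auto simp: child_def ran_def)
  ultimately show ?thesis by (simp add: vertices_at_def)
qed

lemma parent_at:
  assumes "w \<in> vertices_at q n"
  shows "parent w \<in> vertices_at q (n - 1)"
proof -
  have d: "dom w = {..n}" and f: "finite {i. i \<le> n \<and> w i \<noteq> Some 0}" and r: "ran w \<subseteq> {..<q}"
    using assms by (auto simp: vertices_at_def)
  have l: "vlevel w = n" using d by (rule vlevel_eq)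
  have "finite {i. i \<le> n - 1 \<and> parent w i \<noteq> Some 0}"
    by (rule finite_subset[OF _ f]) (auto simp: parent_def l)
  moreover have "dom (parent w) = {..n - 1}"
    using d by (auto simp: parent_def l)
  moreover have "ran (parent w) \<subseteq> {..<q}"
    using r by (auto simp: parent_def ran_def)
  ultimately show ?thesis by (simp add: vertices_at_def)
qed

lemma vlevel_at: "w \<in> vertices_at q n \<Longrightarrow> vlevel w = n"
  by (auto simp: vertices_at_def vlevel_eq)

lemma
  assumes "w \<in> vertices q"
  shows parent_in: "parent w \<in> vertices q"
    and vlevel_parent: "vlevel (parent w) = vlevel w - 1"
  using parent_at[OF verticesE(2)[OF assms]] by (auto simp: vertices_def vlevel_at)

lemma
  assumes "w \<in> vertices q" "j < q"
  shows child_in: "child w j \<in> vertices q"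
    and vlevel_child: "vlevel (child w j) = vlevel w + 1"
  using child_at[OF verticesE(2)[OF assms(1)] assms(2)] by (auto simp: vertices_def vlevel_at)

lemma parent_child:
  assumes "w \<in> vertices q" "j < q"
  shows "parent (child w j) = w"
proof -
  have "w (vlevel w + 1) = None"
    using verticesE(1)[OF assms(1)] by (metis atMost_iff domIff zle_add1_eq_le less_irrefl)
  then show ?thesis
    using vlevel_child[OF assms] by (auto simp: parent_def child_def)
qed

lemma child_parent:
  assumes "w \<in> vertices q"
  obtains j where "j < q" "w = child (parent w) j"
proof -
  from verticesE(1)[OF assms] obtain j where j: "w (vlevel w) = Some j" by blast
  then have "j \<in> ran w" by (auto simp: ran_def)
  then have "j < q" using verticesE(2)[OF assms] by (auto simp: vertices_at_def)
  moreover have "w = child (parent w) j"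
    using j vlevel_parent[OF assms] by (auto simp: child_def parent_def)
  ultimately show thesis by (rule that)
qed

text \<open>Appending a finite word to a vertex.\<close>

lemma descendant:
  assumes "v \<in> vertices q" "s \<in> words q"
  shows "foldl child v s \<in> vertices q \<and> vlevel (foldl child v s) = vlevel v + int (length s) \<and>
    phi v (foldl child v s) = s"
  using assms(2)
proof (induction s rule: rev_induct)
  case Nil
  then show ?case using assms(1) by (simp add: phi_def)
next
  case (snoc j s)
  let ?u = "foldl child v s"
  have j: "j < q" and s: "s \<in> words q" using snoc.prems by (auto simp: words_def)
  note IH = snoc.IH[OF s]
  have l: "vlevel (child ?u j) = vlevel v + int (length s) + 1"
    using IH vlevel_child[of ?u q j] j by simp
  have "phi v (child ?u j) = map (\<lambda>i. the (child ?u j i)) [vlevel v + 1..vlevel v + int (length s)] @ [j]"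
    unfolding phi_def l using IH by (simp add: upto_rec2 child_def[of ?u])
  also have "map (\<lambda>i. the (child ?u j i)) [vlevel v + 1..vlevel v + int (length s)] = phi v ?u"
    unfolding phi_def using IH by (auto simp: child_def[of ?u])
  finally show ?case using IH l child_in[of ?u q j] j by simp
qed

lemma subtree_eq:
  assumes v: "v \<in> vertices q"
  shows "subtree q v = foldl child v ` words q"
proof (intro equalityI subsetI)
  let ?R = "{(a, b). {a, b} \<in> edges q - {{v, parent v}}}"
  fix u assume "u \<in> subtree q v"
  then have "(v, u) \<in> ?R\<^sup>*" by (simp add: subtree_def)
  then show "u \<in> foldl child v ` words q"
  proof induction
    case base
    have "foldl child v [] \<in> foldl child v ` words q" by (rule imageI) (simp add: words_def)
    then show ?case by simp
  next
    case (step a b)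
    then obtain s where s: "s \<in> words q" "a = foldl child v s" by blast
    have e: "{a, b} \<in> edges q" "{a, b} \<noteq> {v, parent v}" using step by auto
    then consider "b = parent a" | "a = parent b" "b \<in> vertices q"
      by (auto simp: edges_def doubleton_eq_iff)
    then show ?case
    proof cases
      case 1
      then have "s \<noteq> []" using e s by auto
      then obtain t j where t: "s = t @ [j]" by (meson rev_exhaust)
      then have "t \<in> words q" "j < q" using s by (auto simp: words_def)
      then have "b = foldl child v t"
        using 1 s t descendant[OF v, of t] parent_child by auto
      then show ?thesis using \<open>t \<in> words q\<close> by blast
    next
      case 2
      then obtain j where "j < q" "b = child a j" using child_parent by metis
      then have "b = foldl child v (s @ [j])" "s @ [j] \<in> words q"
        using s by (auto simp: words_def)
      then show ?thesis by blast
    qed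
  qed
next
  let ?R = "{(a, b). {a, b} \<in> edges q - {{v, parent v}}}"
  fix u assume "u \<in> foldl child v ` words q"
  then obtain s where s: "s \<in> words q" "u = foldl child v s" by blast
  have "s \<in> words q \<Longrightarrow> (v, foldl child v s) \<in> ?R\<^sup>*"
  proof (induction s rule: rev_induct)
    case (snoc j s)
    let ?a = "foldl child v s"
    have j: "j < q" and s: "s \<in> words q" using snoc.prems by (auto simp: words_def)
    note d = descendant[OF v s]
    have p: "parent (child ?a j) = ?a" using d j parent_child by blast
    have c: "child ?a j \<in> vertices q" using d j child_in by blast
    have "{child ?a j, parent (child ?a j)} \<in> edges q" using c unfolding edges_def by blast
    then have "{?a, child ?a j} \<in> edges q" unfolding p by (simp add: insert_commute)
    moreover have "vlevel (child ?a j) > vlevel v" using d j vlevel_child[of ?a q j] by simp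
    then have "{?a, child ?a j} \<noteq> {v, parent v}"
      using vlevel_parent[OF v] by (auto simp: doubleton_eq_iff)
    ultimately have "(?a, child ?a j) \<in> ?R" by auto
    then show ?case using snoc.IH[OF s] by (auto intro: rtrancl_into_rtrancl)
  qed simp
  then show "u \<in> subtree q v" using s by (simp add: subtree_def)
qed

lemma phi_inv_eq:
  assumes "v \<in> vertices q" "s \<in> words q"
  shows "phi_inv q v s = foldl child v s"
  unfolding phi_inv_def subtree_eq[OF assms(1)]
  using assms descendant[OF assms(1)]
  by (intro inv_into_f_eq) (auto intro!: inj_onI)

lemma ancestor_at:
  assumes "w \<in> vertices_at q n"
  shows "ancestor_ray w k \<in> vertices_at q (n - int k)"
proof (induction k)
  case (Suc k)
  then have "parent (ancestor_ray w k) \<in> vertices_at q (n - int k - 1)" by (rule parent_at)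
  then show ?case by (simp add: ancestor_ray_def algebra_simps)
qed (use assms in \<open>simp add: ancestor_ray_def\<close>)

lemma ancestor_apply:
  assumes "w \<in> vertices_at q n"
  shows "ancestor_ray w k i = (if i \<le> n - int k then w i else None)"
proof (induction k)
  case 0
  then show ?case using assms by (auto simp: ancestor_ray_def vertices_at_def)
next
  case (Suc k)
  have "ancestor_ray w (Suc k) i = parent (ancestor_ray w k) i"
    by (simp add: ancestor_ray_def)
  then show ?case
    using Suc vlevel_at[OF ancestor_at[OF assms, of k]] by (auto simp: parent_def)
qed

lemma ancestor_ray_ray:
  assumes "w \<in> vertices q"
  shows "ancestor_ray w \<in> rays q"
proof -
  let ?n = "vlevel w"
  note a = ancestor_at[OF verticesE(2)[OF assms]]
  have "inj (ancestor_ray w)"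
  proof (rule injI)
    fix k m assume "ancestor_ray w k = ancestor_ray w m"
    then have "?n - int k = ?n - int m" using vlevel_at[OF a] by metis
    then show "k = m" by simp
  qed
  moreover have "ancestor_ray w k \<in> vertices q" for k using a by (auto simp: vertices_def)
  moreover from this have "{ancestor_ray w k, ancestor_ray w (Suc k)} \<in> edges q" for k
    by (auto simp: edges_def ancestor_ray_def)
  ultimately show ?thesis by (auto simp: rays_def)
qed

lemma ancestor_ray_in_omega:
  assumes "w \<in> vertices q" "q > 0"
  shows "ancestor_ray w \<in> omega q"
proof -
  define z :: vertex where "z = (\<lambda>i. if i \<le> 0 then Some 0 else None)"
  define n where "n = vlevel w"
  have z0: "{i. i \<le> 0 \<and> z i \<noteq> Some 0} = {}" by (auto simp: z_def)
  have z: "z \<in> vertices_at q 0"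
    unfolding vertices_at_def mem_Collect_eq z0
    using assms(2) by (auto simp: z_def dom_def ran_def split: if_splits)
  have w: "w \<in> vertices_at q n" using verticesE(2)[OF assms(1)] by (simp add: n_def)
  define F where "F = {i. i \<le> n \<and> w i \<noteq> Some 0}"
  have "finite F" using w by (simp add: F_def vertices_at_def)
  then have "bdd_below F" by (rule bdd_below_finite)
  then obtain M where M: "\<And>i. i \<in> F \<Longrightarrow> M \<le> i" by (auto simp: bdd_below_def)
  define m where "m = min (M - 1) (min n 0)"
  have eq: "ancestor_ray w (nat (n - (m - int k))) = ancestor_ray z (nat (0 - (m - int k)))" for k
  proof
    fix i
    have mle: "m \<le> n" "m \<le> 0" by (auto simp: m_def)
    have zi: "i \<le> m \<Longrightarrow> z i = Some 0" using mle by (simp add: z_def)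
    have "i \<le> m \<Longrightarrow> w i = Some 0" using M by (force simp: F_def m_def)
    then show "ancestor_ray w (nat (n - (m - int k))) i = ancestor_ray z (nat (0 - (m - int k))) i"
      using mle zi by (auto simp: ancestor_apply[OF w] ancestor_apply[OF z])
  qed
  let ?f = "\<lambda>k. ancestor_ray z (nat (0 - (m - int k)))"
  have r: "ancestor_ray z \<in> rays q" "ancestor_ray w \<in> rays q"
    using ancestor_ray_ray assms z by (auto simp: vertices_def)
  have "inj ?f"
  proof (rule injI)
    fix k l assume "?f k = ?f l"
    then have "nat (0 - (m - int k)) = nat (0 - (m - int l))"
      using r(1) by (auto simp: rays_def dest: injD)
    then show "k = l" by (auto simp: m_def)
  qed
  then have "infinite (range ?f)" using finite_imageD by blast
  moreover have "range ?f \<subseteq> range (ancestor_ray z) \<inter> range (ancestor_ray w)"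
    using eq by (metis (no_types, lifting) IntI image_subset_iff rangeI)
  ultimately have "infinite (range (ancestor_ray z) \<inter> range (ancestor_ray w))"
    by (meson finite_subset)
  then show ?thesis using r unfolding omega_def ray_equiv_def z_def[symmetric] by blast
qed

lemma words_edge_iff:
  "a \<in> words q \<Longrightarrow> b \<in> words q \<Longrightarrow>
    {a, b} \<in> word_edges q \<longleftrightarrow> (\<exists>j. b = a @ [j]) \<or> (\<exists>j. a = b @ [j])"
  by (fastforce simp: word_edges_def words_def doubleton_eq_iff)

lemma word_isom_child:
  assumes g: "g \<in> Isom_words q" and "w \<in> words q" "j < q"
  shows "\<exists>k. g (w @ [j]) = g w @ [k]"
  using assms(2,3)
proof (induction w arbitrary: j rule: rev_induct)
  case Nil
  have B: "g \<in> Bij (words q)" and r: "g [] = []" using g by (auto simp: rooted_isom_def isom_def)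
  have m: "[] \<in> words q" "[j] \<in> words q" using Nil by (auto simp: words_def)
  then have "{g [], g [j]} \<in> word_edges q"
    using g words_edge_iff[OF m] by (auto simp: rooted_isom_def isom_def)
  then show ?case using r words_edge_iff[of "g []" q "g [j]"] m Bij_imp_funcset[OF B]
    by (fastforce simp: Pi_iff)
next
  case (snoc i w)
  have B: "g \<in> Bij (words q)" using g by (auto simp: rooted_isom_def isom_def)
  have m: "w \<in> words q" "w @ [i] \<in> words q" "w @ [i, j] \<in> words q" "i < q"
    using snoc.prems by (auto simp: words_def)
  have gm: "g x \<in> words q" if "x \<in> words q" for x
    using Bij_imp_funcset[OF B] that by (auto simp: Pi_iff)
  obtain k where k: "g (w @ [i]) = g w @ [k]" using snoc.IH m by blast
  have "{g (w @ [i]), g (w @ [i, j])} \<in> word_edges q"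
    using g m words_edge_iff[OF m(2,3)] by (auto simp: rooted_isom_def isom_def)
  then consider (c) l where "g (w @ [i, j]) = g (w @ [i]) @ [l]"
    | (p) l where "g (w @ [i]) = g (w @ [i, j]) @ [l]"
    using words_edge_iff[OF gm[OF m(2)] gm[OF m(3)]] by blast
  then show ?case
  proof cases
    case c
    then show ?thesis by simp
  next
    case p
    then have "g (w @ [i, j]) = g w" using k by simp
    then have "w @ [i, j] = w" using B m by (auto simp: Bij_def bij_betw_def dest: inj_onD)
    then show ?thesis by simp
  qed
qed

lemma word_section_eq:
  assumes g: "g \<in> Isom_words q" and w: "w \<in> words q" and u: "u \<in> words q"
  shows "g (w @ u) = g w @ word_section q g w u"
proof -
  have "u \<in> words q \<Longrightarrow> \<exists>t. g (w @ u) = g w @ t"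
  proof (induction u rule: rev_induct)
    case (snoc j u)
    then have "u \<in> words q" "j < q" by (auto simp: words_def)
    moreover from this have "w @ u \<in> words q" using w by (auto simp: words_def)
    ultimately show ?case using snoc.IH word_isom_child[OF g, of "w @ u" j] by fastforce
  qed simp
  then obtain t where "g (w @ u) = g w @ t" using u by blast
  then show ?thesis using u by (simp add: word_section_def)
qed

end

theory Submission
  imports Defs
begin

text \<open>
  An automorphism fixing \<open>\<omega>\<close> commutes with \<^const>\<open>parent\<close>, since the rays of \<open>\<omega>\<close> are exactly
  the ancestor rays. Hence sections satisfy the cocycle rule
  \<open>(hg)|\<^sub>v = h|\<^bsub>g v\<^esub> g|\<^sub>v\<close>. Compatibility of the labelling provides, for all
  \<open>u\<close> and \<open>v\<close>, an element of \<open>P\<close> that maps \<open>u\<close> to \<open>v\<close> and has trivial section at \<open>u\<close>; composing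
  with such elements on either side moves the base point or turns a given element into one
  that fixes \<open>v\<close>. An element fixing \<open>vw\<close> also fixes \<open>v\<close>, which gives the self-replication.
  Finally \<open>P\<^sub>v\<close> has finite orbits, so it is compact, and therefore its continuous image
  \<open>P|\<^sub>v\<close> is closed.
\<close>

section \<open>Permutation groups with the topology of pointwise convergence\<close>

text \<open>\<open>perm_group V A\<close> inherits its operations from \<open>BijGroup V\<close>, so
  subgroups can be tested there, where product and inverse are the explicit terms
  \<open>compose\<close> and \<open>inv_into\<close>.\<close>

lemma subgroup_perm_group_iff:
  assumes A: "subgroup A (BijGroup V)"
  shows "subgroup H (perm_group V A) \<longleftrightarrow>
    H \<subseteq> A \<and> (\<lambda>x\<in>V. x) \<in> H \<and> (\<forall>g\<in>H. \<forall>h\<in>H. compose V g h \<in> H) \<and>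
    (\<forall>g\<in>H. restrict (inv_into V g) V \<in> H)"
proof -
  interpret B: group "BijGroup V" by (rule group_BijGroup)
  have AB: "A \<subseteq> Bij V" using subgroup.subset[OF A] by (simp add: BijGroup_def)
  have "subgroup H (perm_group V A) \<longleftrightarrow> H \<subseteq> A \<and> subgroup H (BijGroup V)"
    using B.incl_subgroup[OF A] B.subgroup_incl[OF _ A] subgroup.subset
    unfolding perm_group_def by fastforce
  also have "\<dots> \<longleftrightarrow> H \<subseteq> A \<and> (\<lambda>x\<in>V. x) \<in> H \<and> (\<forall>g\<in>H. \<forall>h\<in>H. compose V g h \<in> H) \<and>
    (\<forall>g\<in>H. restrict (inv_into V g) V \<in> H)" (is "?l \<longleftrightarrow> ?r")
  proof (cases "H \<subseteq> A")
    case True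
    then have HB: "g \<in> Bij V" if "g \<in> H" for g using AB that by blast
    have m: "g \<otimes>\<^bsub>BijGroup V\<^esub> h = compose V g h" if "g \<in> H" "h \<in> H" for g h
      using HB that by (simp add: BijGroup_def)
    have i: "inv\<^bsub>BijGroup V\<^esub> g = restrict (inv_into V g) V" if "g \<in> H" for g
      using HB that by (simp add: inv_BijGroup)
    have o: "\<one>\<^bsub>BijGroup V\<^esub> = (\<lambda>x\<in>V. x)" by (simp add: BijGroup_def)
    have c: "H \<subseteq> carrier (BijGroup V)" using HB by (auto simp: BijGroup_def)
    show ?thesis using True m i o c by (auto simp: subgroup_def)
  qed simp
  finally show ?thesis .
qed

lemma subgroup_isom: "subgroup (isom V E) (BijGroup V)"
  using group.group_incl_imp_subgroup[OF group_BijGroup, of "isom V E" V] group_isom[of V E]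
  by (auto simp: perm_group_def isom_def BijGroup_def)

lemma
  assumes "g \<in> Bij V" "x \<in> V"
  shows Bij_in: "g x \<in> V"
    and Bij_inv_in: "inv_into V g x \<in> V"
    and Bij_f_inv: "g (inv_into V g x) = x"
    and Bij_inv_f: "inv_into V g (g x) = x"
proof -
  have "bij_betw g V V" using assms(1) by (simp add: Bij_def)
  then show "g x \<in> V" "inv_into V g x \<in> V" "g (inv_into V g x) = x" "inv_into V g (g x) = x"
    using assms(2) by (auto simp: bij_betw_def inv_into_into f_inv_into_f)
qed

lemma subgroup_vertex_stabiliser:
  assumes A: "subgroup A (BijGroup V)" and H: "subgroup H (perm_group V A)" and v: "v \<in> V"
  shows "subgroup (vertex_stabiliser H v) (perm_group V A)"
proof -
  have AB: "A \<subseteq> Bij V" using subgroup.subset[OF A] by (simp add: BijGroup_def)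
  have "inv_into V g v = v" if "g \<in> H" "g v = v" for g
    using Bij_inv_f[of g V v] that H[unfolded subgroup_perm_group_iff[OF A]] AB v by auto
  then show ?thesis
    using H v unfolding subgroup_perm_group_iff[OF A]
    by (auto simp: vertex_stabiliser_def compose_def)
qed

text \<open>The rooted automorphisms are the stabiliser of \<open>r\<close> in
  \<open>isom V E\<close>.\<close>

lemma subgroup_rooted_isom:
  assumes "r \<in> V"
  shows "subgroup (rooted_isom V E r) (BijGroup V)"
proof -
  have "subgroup (isom V E) (perm_group V (isom V E))"
    using group.subgroup_self[OF group_isom[of V E]] by (simp add: perm_group_def)
  from subgroup_vertex_stabiliser[OF subgroup_isom this assms]
  have "subgroup (rooted_isom V E r) (perm_group V (isom V E))"
    by (simp add: rooted_isom_def vertex_stabiliser_def)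
  then show ?thesis
    unfolding perm_group_def by (rule group.incl_subgroup[OF group_BijGroup subgroup_isom])
qed

text \<open>Since \<open>V\<close> is discrete, the maps agreeing with \<open>f\<close> on a given
  finite set form a basic neighbourhood of \<open>f\<close>. Hence \<open>f\<close> is in the
  closure of \<open>H\<close> exactly when \<open>H\<close> matches \<open>f\<close> on every finite
  \<open>F\<close>.\<close>

lemma closedin_pointwise_iff:
  assumes A: "A \<subseteq> V \<rightarrow>\<^sub>E V"
  shows "closedin (pointwise_topology V A) H \<longleftrightarrow>
    H \<subseteq> A \<and> (\<forall>f\<in>A. (\<forall>F. finite F \<and> F \<subseteq> V \<longrightarrow> (\<exists>h\<in>H. \<forall>x\<in>F. h x = f x)) \<longrightarrow> f \<in> H)"
proof -
  let ?X = "product_topology (\<lambda>_. discrete_topology V) V"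
  have top: "topspace (pointwise_topology V A) = A"
    using A by (auto simp: pointwise_topology_def)
  have "openin (pointwise_topology V A) (A - H) \<longleftrightarrow>
      (\<forall>f\<in>A - H. \<exists>F. finite F \<and> F \<subseteq> V \<and> (\<forall>h\<in>H. \<exists>x\<in>F. h x \<noteq> f x))"
    if HA: "H \<subseteq> A"
  proof
    assume "openin (pointwise_topology V A) (A - H)"
    then obtain T where T: "openin ?X T" "A - H = T \<inter> A"
      by (auto simp: pointwise_topology_def openin_subtopology)
    show "\<forall>f\<in>A - H. \<exists>F. finite F \<and> F \<subseteq> V \<and> (\<forall>h\<in>H. \<exists>x\<in>F. h x \<noteq> f x)"
    proof
      fix f assume "f \<in> A - H"
      then have "f \<in> T" using T by blast
      \<comment> \<open>A basic open box constrains only finitely many coordinates; these form the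
        required \<open>F\<close>.\<close>
      then obtain U where U: "finite {i \<in> V. U i \<noteq> V}" "f \<in> PiE V U" "PiE V U \<subseteq> T"
        using T(1) unfolding openin_product_topology_alt by fastforce
      have "\<exists>x\<in>{i \<in> V. U i \<noteq> V}. h x \<noteq> f x" if "h \<in> H" for h
      proof (rule ccontr)
        assume "\<not> ?thesis"
        then have eq: "h x = f x" if "x \<in> V" "U x \<noteq> V" for x using that by auto
        have "h \<in> V \<rightarrow>\<^sub>E V" using \<open>h \<in> H\<close> HA A by blast
        moreover have "h x \<in> U x" if "x \<in> V" for x
          using that eq[OF that] PiE_mem[OF U(2) that] PiE_mem[OF calculation that]
          by (cases "U x = V") auto
        ultimately have "h \<in> PiE V U" by (simp add: PiE_iff)
        then show False using U(3) T(2) \<open>h \<in> H\<close> HA by blast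
      qed
      then show "\<exists>F. finite F \<and> F \<subseteq> V \<and> (\<forall>h\<in>H. \<exists>x\<in>F. h x \<noteq> f x)"
        using U(1) by (intro exI[of _ "{i \<in> V. U i \<noteq> V}"] conjI ballI) auto
    qed
  next
    assume r: "\<forall>f\<in>A - H. \<exists>F. finite F \<and> F \<subseteq> V \<and> (\<forall>h\<in>H. \<exists>x\<in>F. h x \<noteq> f x)"
    show "openin (pointwise_topology V A) (A - H)"
    proof (rule openin_subopen[THEN iffD2], intro ballI)
      fix f assume f: "f \<in> A - H"
      obtain F where F: "finite F" "F \<subseteq> V" "\<forall>h\<in>H. \<exists>x\<in>F. h x \<noteq> f x"
        using bspec[OF r f] by (elim exE conjE)
      \<comment> \<open>Conversely, this box pins the values of \<open>f\<close> on \<open>F\<close>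
        and leaves the other coordinates free.\<close>
      let ?U = "\<lambda>i. if i \<in> F then {f i} else V"
      have fV: "f \<in> V \<rightarrow>\<^sub>E V" using f A by blast
      have "{i \<in> V. ?U i \<noteq> V} \<subseteq> F" by auto
      then have "finite {i \<in> V. ?U i \<noteq> V}" using F(1) by (rule finite_subset)
      moreover have "?U i \<subseteq> V" if "i \<in> V" for i using PiE_mem[OF fV that] by simp
      ultimately have "openin ?X (PiE V ?U)"
        unfolding openin_PiE_gen topspace_discrete_topology openin_discrete_topology by blast
      then have "openin (pointwise_topology V A) (PiE V ?U \<inter> A)"
        by (auto simp: pointwise_topology_def openin_subtopology)
      moreover have "f \<in> PiE V ?U \<inter> A" using f fV by (auto simp: PiE_iff)
      moreover have "h \<notin> H" if h: "h \<in> PiE V ?U" for h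
      proof -
        have "h x = f x" if "x \<in> F" for x using PiE_mem[OF h, of x] that F(2) by auto
        then show ?thesis using F(3) by blast
      qed
      ultimately show "\<exists>T. openin (pointwise_topology V A) T \<and> f \<in> T \<and> T \<subseteq> A - H"
        by (intro exI[of _ "PiE V ?U \<inter> A"]) blast
    qed
  qed
  moreover define Q where
    "Q f \<longleftrightarrow> (\<forall>F. finite F \<and> F \<subseteq> V \<longrightarrow> (\<exists>h\<in>H. \<forall>x\<in>F. h x = f x))" for f
  have "(\<exists>F. finite F \<and> F \<subseteq> V \<and> (\<forall>h\<in>H. \<exists>x\<in>F. h x \<noteq> f x)) \<longleftrightarrow> \<not> Q f" for f
    by (simp add: Q_def)
  ultimately show ?thesis unfolding closedin_def top Q_def[symmetric] by auto
qed

lemma Bij_subset_PiE: "Bij V \<subseteq> V \<rightarrow>\<^sub>E V"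
  by (auto simp: Bij_def PiE_def bij_betw_def)

text \<open>Fixing \<open>v\<close> is a condition on one coordinate, so it passes to limits:
  approximate on \<open>{v}\<close>.\<close>

lemma closed_subgroup_vertex_stabiliser:
  assumes A: "subgroup A (BijGroup V)" and H: "closed_subgroup V A H" and v: "v \<in> V"
  shows "closed_subgroup V A (vertex_stabiliser H v)"
proof -
  have AB: "A \<subseteq> V \<rightarrow>\<^sub>E V"
    using subgroup.subset[OF A] Bij_subset_PiE by (auto simp: BijGroup_def)
  note iff = closedin_pointwise_iff[OF AB]
  have c: "closedin (pointwise_topology V A) H" using H by (simp add: closed_subgroup_def)
  have "closedin (pointwise_topology V A) (vertex_stabiliser H v)"
    unfolding iff
  proof (intro conjI ballI impI)
    show "vertex_stabiliser H v \<subseteq> A" using c unfolding iff by (auto simp: vertex_stabiliser_def)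
    fix f assume f: "f \<in> A"
      and *: "\<forall>F. finite F \<and> F \<subseteq> V \<longrightarrow> (\<exists>h\<in>vertex_stabiliser H v. \<forall>x\<in>F. h x = f x)"
    have "\<exists>h\<in>H. \<forall>x\<in>F. h x = f x" if "finite F \<and> F \<subseteq> V" for F
      using *[rule_format, OF that] by (auto simp: vertex_stabiliser_def)
    then have "f \<in> H" using c f unfolding iff by simp
    moreover have "f v = v" using *[rule_format, of "{v}"] v by (auto simp: vertex_stabiliser_def)
    ultimately show "f \<in> vertex_stabiliser H v" by (simp add: vertex_stabiliser_def)
  qed
  then show ?thesis
    using subgroup_vertex_stabiliser[OF A _ v] H by (simp add: closed_subgroup_def)
qed

text \<open>\<open>H\<close> lies in the product of its finite orbits, which is compact by
  Tychonoff. It remains to pass from closedness inside \<open>isom V E\<close> to closedness among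
  all maps from \<open>V\<close> to \<open>V\<close>, where a limit of automorphisms might a priori
  lose surjectivity.\<close>

lemma compactin_closed_subgroup:
  assumes H: "closed_subgroup V (isom V E) H"
    and fin: "\<And>u. u \<in> V \<Longrightarrow> finite ((\<lambda>g. g u) ` H)"
  shows "compactin (product_topology (\<lambda>_. discrete_topology V) V) H"
proof -
  let ?X = "product_topology (\<lambda>_. discrete_topology V) V"
  let ?S = "\<lambda>u. (\<lambda>g. g u) ` H"
  have AB: "isom V E \<subseteq> V \<rightarrow>\<^sub>E V" using Bij_subset_PiE by (auto simp: isom_def)
  have sg: "H \<subseteq> isom V E" "(\<lambda>x\<in>V. x) \<in> H" "\<And>g h. g \<in> H \<Longrightarrow> h \<in> H \<Longrightarrow> compose V g h \<in> H"
    "\<And>g. g \<in> H \<Longrightarrow> restrict (inv_into V g) V \<in> H"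
    using H unfolding closed_subgroup_def subgroup_perm_group_iff[OF subgroup_isom] by auto
  have HV: "H \<subseteq> V \<rightarrow>\<^sub>E V" using sg(1) AB by blast
  have HB: "g \<in> Bij V" if "g \<in> H" for g using that sg(1) by (auto simp: isom_def)
  have "compactin ?X (PiE V ?S)"
    using fin HV by (auto simp: compactin_PiE compactin_discrete_topology)
  moreover have "H \<subseteq> PiE V ?S" using HV by (auto simp: PiE_iff)
  moreover have "closedin (pointwise_topology V (V \<rightarrow>\<^sub>E V)) H"
    unfolding closedin_pointwise_iff[OF order_refl]
  proof (intro conjI ballI impI)
    fix f assume f: "f \<in> V \<rightarrow>\<^sub>E V"
      and *: "\<forall>F. finite F \<and> F \<subseteq> V \<longrightarrow> (\<exists>h\<in>H. \<forall>x\<in>F. h x = f x)"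
    have inj: "inj_on f V"
    proof (rule inj_onI)
      fix a b assume ab: "a \<in> V" "b \<in> V" "f a = f b"
      obtain h where "h \<in> H" "h a = f a" "h b = f b" using *[rule_format, of "{a, b}"] ab by auto
      then show "a = b" using ab HB[of h] by (metis Bij_inv_f)
    qed
    \<comment> \<open>In the limit, surjectivity is preserved because each finite orbit is permuted.\<close>
    have "u \<in> f ` V" if u: "u \<in> V" for u
    proof -
      have SV: "?S u \<subseteq> V" using Bij_in[OF HB u] by auto
      have "\<exists>h\<in>H. \<forall>x\<in>?S u. h x = f x"
        by (rule *[rule_format]) (use fin[OF u] SV in simp)
      then obtain h where h: "h \<in> H" "\<And>x. x \<in> ?S u \<Longrightarrow> h x = f x" by blast
      have w: "inv_into V h u \<in> ?S u" by (rule image_eqI[OF _ sg(4)[OF h(1)]]) (simp add: u)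
      have "u = f (inv_into V h u)"
        using h(2)[OF w] Bij_f_inv[OF HB[OF h(1)] u] by simp
      then show ?thesis using subsetD[OF SV w] by (rule image_eqI)
    qed
    then have "bij_betw f V V" using inj f by (auto simp: bij_betw_def)
    moreover have "{f a, f b} \<in> E \<longleftrightarrow> {a, b} \<in> E" if ab: "a \<in> V" "b \<in> V" for a b
    proof -
      obtain h where "h \<in> H" "h a = f a" "h b = f b" using *[rule_format, of "{a, b}"] ab by auto
      then show ?thesis using sg(1) ab unfolding isom_def by force
    qed
    ultimately have "f \<in> isom V E" using f by (auto simp: isom_def Bij_def PiE_def)
    then show "f \<in> H"
      using H * unfolding closed_subgroup_def closedin_pointwise_iff[OF AB] by simp
  qed (use HV in auto)
  then have "closedin ?X H"
    using subtopology_topspace[of ?X] by (simp add: pointwise_topology_def)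
  ultimately show ?thesis using closed_compactin by blast
qed

section \<open>Automorphisms fixing the distinguished end\<close>

lemma edge_cases:
  assumes "{a, b} \<in> edges q"
  shows "b = parent a \<or> a = parent b"
  using assms by (auto simp: edges_def doubleton_eq_iff)

text \<open>A ray that once steps to a child can never turn back, by injectivity, so its levels grow
  from there on. It then meets the ancestor ray of the zero string, whose levels are at most 0, only
  finitely often.\<close>

lemma omega_ray_parent:
  assumes r: "r \<in> omega q"
  shows "r (Suc n) = parent (r n)"
proof (rule ccontr)
  assume down: "r (Suc n) \<noteq> parent (r n)"
  define z :: vertex where "z = (\<lambda>i. if i \<le> 0 then Some 0 else None)"
  have r': "r \<in> rays q" "ancestor_ray z \<in> rays q" "infinite (range (ancestor_ray z) \<inter> range r)"
    using r unfolding omega_def ray_equiv_def z_def by auto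
  have V: "r k \<in> vertices q" and e: "{r k, r (Suc k)} \<in> edges q" and i: "inj r" for k
    using r'(1) by (auto simp: rays_def)
  have "r (n + k) = parent (r (Suc (n + k)))" for k
  proof (induction k)
    case 0
    then show ?case using down edge_cases[OF e] by auto
  next
    case (Suc k)
    have "r (Suc (Suc (n + k))) \<noteq> r (n + k)" using i by (auto dest: injD)
    then show ?case using Suc edge_cases[OF e[of "Suc (n + k)"]] by auto
  qed
  then have l: "vlevel (r (n + k)) = vlevel (r n) + int k" for k
  proof (induction k)
    case (Suc k)
    then show ?case using vlevel_parent[OF V[of "Suc (n + k)"]] by simp
  qed simp
  have "ancestor_ray z 0 \<in> vertices q" using r'(2) by (auto simp: rays_def)
  then have zV: "z \<in> vertices q" by (simp add: ancestor_ray_def)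
  have "dom z = {..0}" by (auto simp: z_def split: if_splits)
  then have z0: "vlevel z = 0" by (rule vlevel_eq)
  have "vlevel (ancestor_ray z k) \<le> 0" for k
    using vlevel_at[OF ancestor_at[OF verticesE(2)[OF zV], of k]] z0 by simp
  then have "vlevel (r k) \<le> 0" if "r k \<in> range (ancestor_ray z)" for k using that by auto
  \<comment> \<open>Beyond this index the level of \<open>r k\<close> is positive.\<close>
  then have k: "k \<le> n + nat (- vlevel (r n))" if "r k \<in> range (ancestor_ray z)" for k
    using that l[of "k - n"] by (cases "k \<le> n") force+
  have "range (ancestor_ray z) \<inter> range r \<subseteq> r ` {..n + nat (- vlevel (r n))}"
  proof
    fix y assume y: "y \<in> range (ancestor_ray z) \<inter> range r"
    then obtain m where "y = r m" by blast
    then show "y \<in> r ` {..n + nat (- vlevel (r n))}" using y k[of m] by simp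
  qed
  then show False using r'(3) finite_subset by blast
qed

text \<open>A local form of fixing \<open>omega\<close>: equations at vertices replace statements
  about rays.\<close>

definition parent_auts :: "nat \<Rightarrow> (vertex \<Rightarrow> vertex) set" where
  "parent_auts q = {g \<in> Bij (vertices q). \<forall>w\<in>vertices q. g (parent w) = parent (g w)}"

text \<open>The image of the ancestor ray of \<open>w\<close> is again a ray of
  \<open>omega\<close>; compare its first two vertices.\<close>

lemma fixes_omega_parent_auts:
  assumes "q > 0" "g \<in> Isom_tree q" "fixes_omega q g"
  shows "g \<in> parent_auts q"
proof -
  have "g (parent w) = parent (g w)" if "w \<in> vertices q" for w
  proof -
    have "g \<circ> ancestor_ray w \<in> omega q"
      using ancestor_ray_in_omega[OF that assms(1)] assms(3) unfolding fixes_omega_def by blast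
    from omega_ray_parent[OF this, of 0] show ?thesis by (simp add: ancestor_ray_def)
  qed
  then show ?thesis using assms(2) by (auto simp: parent_auts_def isom_def)
qed

lemma
  assumes "g \<in> parent_auts q"
  shows parent_auts_Bij: "g \<in> Bij (vertices q)"
    and parent_auts_in: "w \<in> vertices q \<Longrightarrow> g w \<in> vertices q"
    and parent_auts_parent: "w \<in> vertices q \<Longrightarrow> g (parent w) = parent (g w)"
  using assms Bij_in by (auto simp: parent_auts_def)

lemma parent_auts_inv:
  assumes g: "g \<in> parent_auts q"
  shows "restrict (inv_into (vertices q) g) (vertices q) \<in> parent_auts q"
proof -
  note B = parent_auts_Bij[OF g]
  have "inv_into (vertices q) g (parent w) = parent (inv_into (vertices q) g w)"
    if w: "w \<in> vertices q" for w
  proof -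
    let ?u = "inv_into (vertices q) g w"
    have u: "?u \<in> vertices q" "g ?u = w" using Bij_inv_in[OF B w] Bij_f_inv[OF B w] by auto
    then have "parent w = g (parent ?u)" using parent_auts_parent[OF g] by metis
    then show ?thesis using Bij_inv_f[OF B] parent_in[OF u(1)] by simp
  qed
  then show ?thesis
    using restrict_inv_into_Bij[OF B] by (auto simp: parent_auts_def parent_in)
qed

section \<open>Ancestors and descendants under end-fixing automorphisms\<close>

lemma parent_funpow_in: "w \<in> vertices q \<Longrightarrow> (parent ^^ k) w \<in> vertices q"
  by (induction k) (auto simp: parent_in)

lemma parent_auts_funpow:
  assumes "g \<in> parent_auts q" "w \<in> vertices q"
  shows "g ((parent ^^ k) w) = (parent ^^ k) (g w)"
  by (induction k) (auto simp: parent_auts_parent[OF assms(1)] parent_funpow_in[OF assms(2)])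

lemma parent_funpow_descendant:
  assumes "v \<in> vertices q" "s \<in> words q"
  shows "(parent ^^ length s) (foldl child v s) = v"
  using assms(2)
proof (induction s rule: rev_induct)
  case (snoc j s)
  then have "j < q" "s \<in> words q" by (auto simp: words_def)
  moreover from this have "parent (child (foldl child v s) j) = foldl child v s"
    using descendant[OF assms(1)] parent_child by blast
  ultimately show ?case using snoc.IH by (simp add: funpow_swap1)
qed simp

lemma descendant_parent_funpow:
  assumes "w \<in> vertices q"
  shows "\<exists>s\<in>words q. length s = k \<and> w = foldl child ((parent ^^ k) w) s"
proof (induction k)
  case 0
  show ?case by (auto simp: words_def)
next
  case (Suc k)
  then obtain s where s: "s \<in> words q" "length s = k" "w = foldl child ((parent ^^ k) w) s" by blast
  obtain j where "j < q" "(parent ^^ k) w = child ((parent ^^ Suc k) w) j"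
    using child_parent[OF parent_funpow_in[OF assms]] by (metis comp_apply funpow.simps(2))
  then have "w = foldl child ((parent ^^ Suc k) w) (j # s)" "j # s \<in> words q"
    using s by (auto simp: words_def)
  then show ?case using s(2) by (metis length_Cons)
qed

text \<open>The ancestor rays of \<open>u\<close> and \<open>v\<close> both meet that of the zero
  string \<open>z\<close>, and from the later meeting point on all three coincide.\<close>

lemma common_ancestor:
  assumes "u \<in> vertices q" "v \<in> vertices q" "q > 0"
  shows "\<exists>k l. (parent ^^ k) u = (parent ^^ l) v"
proof -
  define z :: vertex where "z = (\<lambda>i. if i \<le> 0 then Some 0 else None)"
  have *: "\<exists>k l. (parent ^^ k) w = (parent ^^ l) z" if "w \<in> vertices q" for w
  proof -
    have "infinite (range (ancestor_ray z) \<inter> range (ancestor_ray w))"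
      using ancestor_ray_in_omega[OF that assms(3)]
      unfolding omega_def ray_equiv_def z_def[symmetric] by simp
    then have "range (ancestor_ray z) \<inter> range (ancestor_ray w) \<noteq> {}"
      by (rule infinite_imp_nonempty)
    then obtain k l where "ancestor_ray z l = ancestor_ray w k" by blast
    then have "(parent ^^ k) w = (parent ^^ l) z" by (simp add: ancestor_ray_def)
    then show ?thesis by blast
  qed
  obtain k l where u: "(parent ^^ k) u = (parent ^^ l) z" using *[OF assms(1)] by blast
  obtain k' l' where v: "(parent ^^ k') v = (parent ^^ l') z" using *[OF assms(2)] by blast
  have "(parent ^^ (l' + k)) u = (parent ^^ (l' + l)) z" using u by (simp add: funpow_add)
  also have "\<dots> = (parent ^^ (l + l')) z" by (simp only: add.commute)
  also have "\<dots> = (parent ^^ (l + k')) v" using v by (simp add: funpow_add)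
  finally show ?thesis by blast
qed

text \<open>Climbing \<open>length s\<close> steps from the image of \<open>foldl child v s\<close>
  leads to \<open>g v\<close>, so this image lies below \<open>g v\<close> at the same
  depth.\<close>

lemma parent_auts_descendant:
  assumes g: "g \<in> parent_auts q" and v: "v \<in> vertices q" and s: "s \<in> words q"
  shows "\<exists>t\<in>words q. length t = length s \<and> g (foldl child v s) = foldl child (g v) t"
proof -
  have "foldl child v s \<in> vertices q" using descendant[OF v s] by blast
  then show ?thesis
    using descendant_parent_funpow[OF parent_auts_in[OF g], of "foldl child v s" "length s"]
      parent_auts_funpow[OF g, of "foldl child v s" "length s"] parent_funpow_descendant[OF v s]
    by metis
qed

text \<open>An automorphism fixing \<open>v\<close> fixes every ancestor of \<open>v\<close>, in
  particular one shared with \<open>u\<close> at height \<open>k\<close> above \<open>u\<close>. So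
  \<open>u\<close> has at most \<open>q ^ k\<close> images.\<close>

lemma finite_stabiliser_orbit:
  assumes "H \<subseteq> parent_auts q" "u \<in> vertices q" "v \<in> vertices q" "q > 0"
  shows "finite ((\<lambda>g. g u) ` vertex_stabiliser H v)"
proof -
  obtain k l where kl: "(parent ^^ k) u = (parent ^^ l) v" using common_ancestor assms by blast
  let ?a = "(parent ^^ k) u"
  obtain s where s: "s \<in> words q" "length s = k" "u = foldl child ?a s"
    using descendant_parent_funpow[OF assms(2)] by blast
  have "g u \<in> foldl child ?a ` {t. set t \<subseteq> {..<q} \<and> length t = k}"
    if g: "g \<in> parent_auts q" "g v = v" for g
  proof -
    have "g ?a = ?a" unfolding kl using parent_auts_funpow[OF g(1) assms(3)] g(2) by simp
    moreover obtain t where "t \<in> words q" "length t = k" "g u = foldl child (g ?a) t"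
      using parent_auts_descendant[OF g(1) parent_funpow_in[OF assms(2)] s(1)] s by metis
    ultimately show ?thesis by (auto simp: words_def lists_eq_set)
  qed
  then have "(\<lambda>g. g u) ` vertex_stabiliser H v \<subseteq>
      foldl child ?a ` {t. set t \<subseteq> {..<q} \<and> length t = k}"
    using assms(1) by (auto simp: vertex_stabiliser_def)
  then show ?thesis
    by (rule finite_subset) (simp add: finite_lists_length_eq)
qed

section \<open>Sections\<close>

text \<open>\<open>phi (g v)\<close> recovers the word appended to \<open>g v\<close>. Later
  sections are computed by exhibiting such a \<open>t\<close>.\<close>

lemma tree_section_unique:
  assumes "g \<in> parent_auts q" "v \<in> vertices q" "s \<in> words q" "t \<in> words q"
    and "g (foldl child v s) = foldl child (g v) t"
  shows "tree_section q g v s = t"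
  using assms descendant[OF parent_auts_in[OF assms(1,2)] assms(4)]
  by (simp add: tree_section_def phi_inv_eq)

lemma
  assumes "g \<in> parent_auts q" "v \<in> vertices q" "s \<in> words q"
  shows tree_section_in: "tree_section q g v s \<in> words q"
    and tree_section_eq: "g (foldl child v s) = foldl child (g v) (tree_section q g v s)"
  using parent_auts_descendant[OF assms] tree_section_unique[OF assms] by auto

lemma tree_section_id:
  assumes "v \<in> vertices q"
  shows "tree_section q (\<lambda>x\<in>vertices q. x) v = (\<lambda>s\<in>words q. s)"
  using assms descendant[OF assms] by (auto simp: tree_section_def phi_inv_eq)

text \<open>The cocycle rule: \<open>g\<close> carries the address \<open>s\<close> below
  \<open>v\<close> to an address below \<open>g v\<close>, on which the section of \<open>h\<close>
  at \<open>g v\<close> acts.\<close>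

lemma tree_section_compose:
  assumes h: "h \<in> parent_auts q" and g: "g \<in> parent_auts q" and v: "v \<in> vertices q"
  shows "tree_section q (compose (vertices q) h g) v =
    compose (words q) (tree_section q h (g v)) (tree_section q g v)"
proof
  fix s
  show "tree_section q (compose (vertices q) h g) v s =
    compose (words q) (tree_section q h (g v)) (tree_section q g v) s"
  proof (cases "s \<in> words q")
    case True
    note gs = tree_section_in[OF g v True]
    have "tree_section q (compose (vertices q) h g) v s = phi (h (g v)) (h (g (foldl child v s)))"
      using True v descendant[OF v True] by (simp add: tree_section_def phi_inv_eq compose_def)
    also have "\<dots> = tree_section q h (g v) (tree_section q g v s)"
      using gs parent_auts_in[OF g v] tree_section_eq[OF g v True]
      by (simp add: tree_section_def[of q h] phi_inv_eq)
    finally show ?thesis using True by (simp add: compose_def)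
  qed (simp add: tree_section_def compose_def)
qed

lemma tree_section_append:
  assumes g: "g \<in> parent_auts q" and v: "v \<in> vertices q" and w: "w \<in> words q" and u: "u \<in> words q"
  shows "tree_section q g v (w @ u) = tree_section q g v w @ tree_section q g (foldl child v w) u"
proof (rule tree_section_unique[OF g v])
  have vw: "foldl child v w \<in> vertices q" using descendant[OF v w] by blast
  show "w @ u \<in> words q" using w u by (auto simp: words_def)
  show "tree_section q g v w @ tree_section q g (foldl child v w) u \<in> words q"
    using tree_section_in[OF g v w] tree_section_in[OF g vw u] by (auto simp: words_def)
  show "g (foldl child v (w @ u)) =
    foldl child (g v) (tree_section q g v w @ tree_section q g (foldl child v w) u)"
    using tree_section_eq[OF g v w] tree_section_eq[OF g vw u] by simp
qed

text \<open>Links the two kinds of section: dropping the image of \<open>w\<close> in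
  \<open>tree_section_append\<close> leaves the section at the descendant of
  \<open>v\<close>.\<close>

lemma word_section_tree_section:
  assumes "g \<in> parent_auts q" "v \<in> vertices q" "w \<in> words q"
  shows "word_section q (tree_section q g v) w = tree_section q g (foldl child v w)"
  using tree_section_append[OF assms]
  by (auto simp: word_section_def tree_section_def[of q g "foldl child v w"])

text \<open>By the cocycle rule, the section at \<open>g v\<close> of the inverse of
  \<open>g\<close> is a two-sided inverse of the section of \<open>g\<close> at
  \<open>v\<close>.\<close>

lemma tree_section_Isom:
  assumes g: "g \<in> parent_auts q" and v: "v \<in> vertices q"
  shows "tree_section q g v \<in> Isom_words q"
proof -
  let ?V = "vertices q"
  define h where "h = restrict (inv_into ?V g) ?V"
  note B = parent_auts_Bij[OF g]
  have h: "h \<in> parent_auts q" unfolding h_def using parent_auts_inv[OF g] .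
  have gv: "g v \<in> ?V" using parent_auts_in[OF g v] .
  have hgv: "h (g v) = v" using gv Bij_inv_f[OF B v] by (simp add: h_def)
  have "compose ?V h g = (\<lambda>x\<in>?V. x)" "compose ?V g h = (\<lambda>x\<in>?V. x)"
    using Bij_inv_f[OF B] Bij_f_inv[OF B] Bij_in[OF B] by (auto simp: compose_def h_def)
  then have "compose (words q) (tree_section q h (g v)) (tree_section q g v) = (\<lambda>s\<in>words q. s)"
    "compose (words q) (tree_section q g v) (tree_section q h (g v)) = (\<lambda>s\<in>words q. s)"
    using tree_section_compose[OF h g v] tree_section_compose[OF g h gv] hgv
      tree_section_id[OF v] tree_section_id[OF gv] by simp_all
  then have inv: "tree_section q h (g v) (tree_section q g v s) = s"
    "tree_section q g v (tree_section q h (g v) s) = s" if "s \<in> words q" for s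
    using that by (metis compose_eq restrict_apply')+
  have "bij_betw (tree_section q g v) (words q) (words q)"
    by (rule bij_betw_byWitness[where f' = "tree_section q h (g v)"])
      (auto simp: inv tree_section_in g v h gv)
  then have 1: "tree_section q g v \<in> Bij (words q)"
    by (simp add: Bij_def tree_section_def)
  \<comment> \<open>Stated for arbitrary \<open>k\<close> and \<open>u\<close>: applied to
    \<open>g\<close> at \<open>v\<close> and to \<open>h\<close> at \<open>g v\<close>, it yields
    both directions of edge preservation.\<close>
  have step: "{tree_section q k u a, tree_section q k u b} \<in> word_edges q"
    if k: "k \<in> parent_auts q" and u: "u \<in> ?V" and e: "{a, b} \<in> word_edges q" for k u a b
  proof -
    have *: "{tree_section q k u w, tree_section q k u (w @ [j])} \<in> word_edges q"
      if w: "w \<in> words q" "j < q" for w j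
    proof -
      have vw: "foldl child u w \<in> ?V" using descendant[OF u w(1)] by blast
      have j: "[j] \<in> words q" using w by (simp add: words_def)
      obtain t where t: "t \<in> words q" "length t = length [j]"
          "k (foldl child (foldl child u w) [j]) = foldl child (k (foldl child u w)) t"
        using parent_auts_descendant[OF k vw j] by blast
      then obtain i where i: "t = [i]" "i < q" by (auto simp: length_Suc_conv words_def)
      then have "tree_section q k (foldl child u w) [j] = [i]"
        using tree_section_unique[OF k vw j t(1,3)] by simp
      then have "tree_section q k u (w @ [j]) = tree_section q k u w @ [i]"
        using tree_section_append[OF k u w(1) j] by simp
      then show ?thesis using tree_section_in[OF k u w(1)] i by (auto simp: word_edges_def)
    qed
    obtain w j where "w \<in> words q" "j < q" "{a, b} = {w, w @ [j]}"
      using e by (auto simp: word_edges_def)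
    then show ?thesis using * by (auto simp: doubleton_eq_iff insert_commute)
  qed
  have "{tree_section q g v a, tree_section q g v b} \<in> word_edges q \<longleftrightarrow> {a, b} \<in> word_edges q"
    if "a \<in> words q" "b \<in> words q" for a b
    using step[OF g v, of a b] step[OF h gv, of "tree_section q g v a" "tree_section q g v b"]
    by (auto simp: inv that)
  moreover have "tree_section q g v [] = []"
    by (rule tree_section_unique[OF g v]) (auto simp: words_def)
  ultimately show ?thesis using 1 by (simp add: rooted_isom_def isom_def)
qed

text \<open>The label of an edge to a child is the appended symbol. An \<open>x\<close> preserving
  labels below \<open>u\<close> therefore copies words symbol by symbol.\<close>

lemma compatible_trivial_section:
  assumes P: "P \<subseteq> parent_auts q" and c: "std_labelling_compatible q P"
    and u: "u \<in> vertices q" and v: "v \<in> vertices q"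
  shows "\<exists>x\<in>P. x u = v \<and> tree_section q x u = (\<lambda>s\<in>words q. s)"
proof -
  obtain x where x: "x \<in> P" "x u = v"
    and lab: "\<And>a b. a \<in> subtree q u \<Longrightarrow> b \<in> subtree q u \<Longrightarrow> {a, b} \<in> edges q \<Longrightarrow>
      std_label q (x a) (x b) = std_label q a b"
    using c u v unfolding std_labelling_compatible_def by metis
  have xa: "x \<in> parent_auts q" using x(1) P by blast
  have l: "std_label q a (child a j) = j" if a: "a \<in> vertices q" "j < q" for a j
  proof -
    have "child a j \<noteq> parent a" using vlevel_child[OF a] vlevel_parent[OF a(1)] by auto
    then show ?thesis using vlevel_child[OF a] by (simp add: std_label_def) (simp add: child_def)
  qed
  have "x (foldl child u s) = foldl child v s" if "s \<in> words q" for s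
    using that
  proof (induction s rule: rev_induct)
    case Nil
    then show ?case using x by simp
  next
    case (snoc j s)
    let ?a = "foldl child u s"
    have s: "s \<in> words q" "j < q" "s @ [j] \<in> words q" using snoc.prems by (auto simp: words_def)
    have a: "?a \<in> vertices q" using descendant[OF u s(1)] by blast
    note xa' = parent_auts_in[OF xa a]
    have ch: "child ?a j \<in> vertices q" using child_in[OF a s(2)] .
    \<comment> \<open>As \<open>x\<close> commutes with \<open>parent\<close>, the child goes to a
      child of the image; only its symbol \<open>k\<close> is open, and the label determines
      it.\<close>
    have par: "parent (x (child ?a j)) = x ?a"
      using parent_auts_parent[OF xa ch] parent_child[OF a s(2)] by simp
    obtain k where k: "k < q" "x (child ?a j) = child (x ?a) k"
      using child_parent[OF parent_auts_in[OF xa ch]] par by metis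
    have "?a \<in> subtree q u" using s by (simp add: subtree_eq[OF u])
    moreover have "child ?a j \<in> subtree q u"
      unfolding subtree_eq[OF u] by (rule image_eqI[OF _ s(3)]) simp
    moreover have "{child ?a j, parent (child ?a j)} \<in> edges q"
      using ch unfolding edges_def by blast
    then have "{?a, child ?a j} \<in> edges q"
      unfolding parent_child[OF a s(2)] by (simp add: insert_commute)
    ultimately have "k = j" using lab l[OF a s(2)] l[OF xa' k(1)] k(2) by metis
    then show ?case using k snoc.IH[OF s(1)] by simp
  qed
  then have "tree_section q x u = (\<lambda>s\<in>words q. s)"
    using tree_section_unique[OF xa u] x(2) by (auto simp: tree_section_def)
  then show ?thesis using x by blast
qed

text \<open>Holds also for \<open>u\<close> outside \<open>subtree q v\<close>. Thus
  \<open>phi v\<close> maps the whole discrete space of vertices to words, as the continuity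
  argument below requires.\<close>

lemma phi_in_words:
  assumes "u \<in> vertices q"
  shows "phi v u \<in> words q"
proof -
  have "the (u i) < q" if "i \<le> vlevel u" for i
  proof -
    have "i \<in> dom u" unfolding verticesE(1)[OF assms] using that by simp
    then obtain j where "u i = Some j" by blast
    then show ?thesis using verticesE(2)[OF assms] by (auto simp: vertices_at_def ran_def)
  qed
  then show ?thesis by (auto simp: phi_def words_def)
qed

section \<open>The group of sections of a scale group\<close>

theorem proposition3p8:
  fixes q :: nat and P :: "(vertex \<Rightarrow> vertex) set"
  assumes "q \<ge> 2"
    and "P \<in> scale_groups q"
    and "std_labelling_compatible q P"
  shows "(\<forall>u\<in>vertices q. \<forall>v\<in>vertices q. group_sections q P u = group_sections q P v) \<and>
    (\<forall>v\<in>vertices q.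
       group_sections q P v =
         {restrict (phi v \<circ> restrict g (subtree q v) \<circ> phi_inv q v) (words q) | g.
            g \<in> vertex_stabiliser P v} \<and>
       closed_subgroup (words q) (Isom_words q) (group_sections q P v) \<and>
       self_replicating q (group_sections q P v))"
proof -
  let ?V = "vertices q" and ?W = "words q"
  \<comment> \<open>Uses \<open>phi v\<close> in place of \<open>phi (g v)\<close>. This agrees with
    the section when \<open>g\<close> fixes \<open>v\<close>, and each of its values depends on
    \<open>g\<close> at one vertex only.\<close>
  let ?r = "\<lambda>v g. restrict (phi v \<circ> g \<circ> phi_inv q v) ?W"
  have q: "q > 0" using assms(1) by simp
  have Pc: "closed_subgroup ?V (Isom_tree q) P" using assms(2) by (simp add: scale_groups_def)
  have Psg: "P \<subseteq> Isom_tree q" "(\<lambda>x\<in>?V. x) \<in> P"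
    "\<And>g h. g \<in> P \<Longrightarrow> h \<in> P \<Longrightarrow> compose ?V g h \<in> P"
    using Pc unfolding closed_subgroup_def subgroup_perm_group_iff[OF subgroup_isom] by auto
  have Pp: "P \<subseteq> parent_auts q"
    using fixes_omega_parent_auts[OF q] Psg(1) assms(2) by (auto simp: scale_groups_def)
  then have PB: "g \<in> parent_auts q" if "g \<in> P" for g using that by blast
  note triv = compatible_trivial_section[OF Pp assms(3)]
  have secE: "tree_section q g v \<in> extensional ?W" for g v by (simp add: tree_section_def)
  have indep_sub: "group_sections q P u \<subseteq> group_sections q P v" if u: "u \<in> ?V" and v: "v \<in> ?V" for u v
  proof
    fix f assume "f \<in> group_sections q P u"
    then obtain x where x: "x \<in> P" "f = tree_section q x u" by (auto simp: group_sections_def)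
    \<comment> \<open>Precomposing with \<open>y\<close> moves the base point from \<open>u\<close>
      to \<open>v\<close> without changing the section.\<close>
    obtain y where y: "y \<in> P" "y v = u" "tree_section q y v = (\<lambda>s\<in>?W. s)" using triv[OF v u] by blast
    have "tree_section q (compose ?V x y) v = f"
      using tree_section_compose[OF PB[OF x(1)] PB[OF y(1)] v] y(2,3) x(2) secE
      by (auto simp: compose_def extensional_def)
    then show "f \<in> group_sections q P v"
      using Psg(3)[OF x(1) y(1)] by (auto simp: group_sections_def)
  qed
  then have indep: "group_sections q P u = group_sections q P v" if "u \<in> ?V" "v \<in> ?V" for u v
    using that by blast
  have stab: "group_sections q P v = (\<lambda>g. tree_section q g v) ` vertex_stabiliser P v"
    if v: "v \<in> ?V" for v
  proof (intro equalityI subsetI)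
    fix f assume "f \<in> group_sections q P v"
    then obtain x where x: "x \<in> P" "f = tree_section q x v" by (auto simp: group_sections_def)
    have xv: "x v \<in> ?V" using parent_auts_in[OF PB[OF x(1)] v] .
    \<comment> \<open>Postcomposing with \<open>y\<close> brings \<open>x v\<close> back to
      \<open>v\<close>, again without changing the section.\<close>
    obtain y where y: "y \<in> P" "y (x v) = v" "tree_section q y (x v) = (\<lambda>s\<in>?W. s)"
      using triv[OF xv v] by blast
    have "tree_section q (compose ?V y x) v = f"
      using tree_section_compose[OF PB[OF y(1)] PB[OF x(1)] v] y(3) x(2) secE
        tree_section_in[OF PB[OF x(1)] v]
      by (auto simp: compose_def extensional_def)
    moreover have "compose ?V y x \<in> vertex_stabiliser P v"
      using Psg(3)[OF y(1) x(1)] y(2) v by (simp add: vertex_stabiliser_def compose_def)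
    ultimately show "f \<in> (\<lambda>g. tree_section q g v) ` vertex_stabiliser P v" by blast
  qed (auto simp: group_sections_def vertex_stabiliser_def)
  have main: "group_sections q P v =
         {restrict (phi v \<circ> restrict g (subtree q v) \<circ> phi_inv q v) ?W | g.
            g \<in> vertex_stabiliser P v} \<and>
       closed_subgroup ?W (Isom_words q) (group_sections q P v) \<and>
       self_replicating q (group_sections q P v)" if v: "v \<in> ?V" for v
  proof -
    let ?G = "group_sections q P v" and ?H = "vertex_stabiliser P v"
    have Hc: "closed_subgroup ?V (Isom_tree q) ?H"
      using closed_subgroup_vertex_stabiliser[OF subgroup_isom Pc v] .
    then have Hsg: "(\<lambda>x\<in>?V. x) \<in> ?H" "\<And>g h. g \<in> ?H \<Longrightarrow> h \<in> ?H \<Longrightarrow> compose ?V g h \<in> ?H"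
      "\<And>g. g \<in> ?H \<Longrightarrow> restrict (inv_into ?V g) ?V \<in> ?H"
      unfolding closed_subgroup_def subgroup_perm_group_iff[OF subgroup_isom] by auto
    have H: "g \<in> P" "g \<in> parent_auts q" "g v = v" if "g \<in> ?H" for g
      using that PB by (auto simp: vertex_stabiliser_def)
    have r: "?r v g = tree_section q g v" if "g \<in> ?H" for g
      using H(3)[OF that] by (simp add: tree_section_def)
    \<comment> \<open>\<open>phi_inv q v\<close> takes its values in \<open>subtree q v\<close>, so
      restricting \<open>g\<close> there changes nothing.\<close>
    have "restrict (phi v \<circ> restrict g (subtree q v) \<circ> phi_inv q v) ?W = ?r v g" for g
      using v by (auto simp: phi_inv_eq subtree_eq)
    then have "restrict (phi v \<circ> restrict g (subtree q v) \<circ> phi_inv q v) ?W = tree_section q g v"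
      if "g \<in> ?H" for g using r[OF that] by (rule trans)
    then have 1: "?G = {restrict (phi v \<circ> restrict g (subtree q v) \<circ> phi_inv q v) ?W | g. g \<in> ?H}"
      unfolding stab[OF v] image_def by (intro Collect_cong) metis
    have GI: "?G \<subseteq> Isom_words q"
      using tree_section_Isom[OF PB v] by (auto simp: group_sections_def)
    have Wsg: "subgroup (Isom_words q) (BijGroup ?W)"
      by (rule subgroup_rooted_isom) (simp add: words_def)
    have comp: "compose ?W (tree_section q h v) (tree_section q g v) = tree_section q (compose ?V h g) v"
      if "h \<in> ?H" "g \<in> ?H" for g h
      using tree_section_compose[OF H(2)[OF that(1)] H(2)[OF that(2)] v] H(3)[OF that(2)] by simp
    \<comment> \<open>By \<open>comp\<close>, taking sections at \<open>v\<close> is multiplicative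
      on the stabiliser, hence respects inverses.\<close>
    have inv: "restrict (inv_into ?W (tree_section q g v)) ?W =
        tree_section q (restrict (inv_into ?V g) ?V) v" if g: "g \<in> ?H" for g
    proof -
      let ?h = "restrict (inv_into ?V g) ?V"
      have B: "g \<in> Bij ?V" using parent_auts_Bij H(2)[OF g] by blast
      have sB: "tree_section q g v \<in> Bij ?W"
        using tree_section_Isom[OF H(2)[OF g] v] by (simp add: rooted_isom_def isom_def)
      have "compose ?V g ?h = (\<lambda>x\<in>?V. x)" using Bij_f_inv[OF B] by (auto simp: compose_def)
      then have "compose ?W (tree_section q g v) (tree_section q ?h v) = (\<lambda>s\<in>?W. s)"
        using comp[OF g Hsg(3)[OF g]] tree_section_id[OF v] by simp
      then have "tree_section q g v (tree_section q ?h v s) = s" if "s \<in> ?W" for s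
        using that by (metis compose_eq restrict_apply')
      then have "inv_into ?W (tree_section q g v) s = tree_section q ?h v s" if "s \<in> ?W" for s
        using that Bij_inv_f[OF sB] tree_section_in[OF H(2)[OF Hsg(3)[OF g]] v] by metis
      then show ?thesis using secE by (auto simp: extensional_def)
    qed
    have Gsg: "subgroup ?G (perm_group ?W (Isom_words q))"
      unfolding subgroup_perm_group_iff[OF Wsg]
    proof (intro conjI ballI)
      show "(\<lambda>x\<in>?W. x) \<in> ?G"
        using tree_section_id[OF v] Hsg(1) unfolding stab[OF v] by (metis imageI)
    next
      fix f k assume "f \<in> ?G" "k \<in> ?G"
      then show "compose ?W f k \<in> ?G" unfolding stab[OF v] using comp Hsg(2) by auto
    next
      fix f assume "f \<in> ?G"
      then show "restrict (inv_into ?W f) ?W \<in> ?G" unfolding stab[OF v] using inv Hsg(3) by auto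
    qed (rule GI)
    have comp_H: "compactin (product_topology (\<lambda>_. discrete_topology ?V) ?V) ?H"
      using compactin_closed_subgroup[OF Hc] finite_stabiliser_orbit[OF Pp _ v q] by blast
    \<comment> \<open>The coordinate at \<open>s\<close> is evaluation of \<open>g\<close> at the
      vertex \<open>phi_inv q v s\<close>, followed by a map out of a discrete space.\<close>
    have cont: "continuous_map (product_topology (\<lambda>_. discrete_topology ?V) ?V)
       (product_topology (\<lambda>_. discrete_topology ?W) ?W) (?r v)"
      unfolding continuous_map_componentwise
    proof (intro conjI ballI)
      fix s assume s: "s \<in> ?W"
      have i: "phi_inv q v s \<in> ?V" using descendant[OF v s] phi_inv_eq[OF v s] by simp
      have "continuous_map (product_topology (\<lambda>_. discrete_topology ?V) ?V) (discrete_topology ?W)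
         (phi v \<circ> (\<lambda>g. g (phi_inv q v s)))"
        by (rule continuous_map_compose[OF continuous_map_product_projection[OF i]])
          (simp add: phi_in_words)
      then show "continuous_map (product_topology (\<lambda>_. discrete_topology ?V) ?V)
         (discrete_topology ?W) (\<lambda>g. ?r v g s)"
        using s by (simp add: o_def)
    qed auto
    have "?G = ?r v ` ?H" unfolding stab[OF v] using r by auto
    then have "compactin (product_topology (\<lambda>_. discrete_topology ?W) ?W) ?G"
      using image_compactin[OF comp_H cont] by simp
    \<comment> \<open>A compact subset of a Hausdorff space is closed.\<close>
    then have "closedin (product_topology (\<lambda>_. discrete_topology ?W) ?W) ?G"
      by (rule compactin_imp_closedin[rotated]) (simp add: Hausdorff_space_product_topology)
    then have "closedin (pointwise_topology ?W (Isom_words q)) ?G"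
      using GI by (auto simp: pointwise_topology_def closedin_subtopology)
    then have 2: "closed_subgroup ?W (Isom_words q) ?G" using Gsg by (simp add: closed_subgroup_def)
    have desc: "foldl child v w \<in> ?V" if "w \<in> ?W" for w using descendant[OF v that] by blast
    \<comment> \<open>Fixing a descendant of \<open>v\<close>, or moving it to one of the same level, forces fixing \<open>v\<close>.\<close>
    have fix_v: "x \<in> ?H \<and> tree_section q x v w = w'"
      if x: "x \<in> P" and w: "w \<in> ?W" "w' \<in> ?W" "length w = length w'"
        "x (foldl child v w) = foldl child v w'" for x w w'
    proof -
      have "x v = v"
        using parent_auts_funpow[OF PB[OF x] desc[OF w(1)], of "length w"] w
          parent_funpow_descendant[OF v w(1)] parent_funpow_descendant[OF v w(2)] by simp
      then show ?thesis
        using tree_section_unique[OF PB[OF x] v w(1,2)] w(4) x by (simp add: vertex_stabiliser_def)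
    qed
    have ws: "word_section q f w \<in> ?G" if f: "f \<in> ?G" and w: "w \<in> ?W" for f w
    proof -
      obtain x where x: "x \<in> P" "f = tree_section q x v" using f by (auto simp: group_sections_def)
      \<comment> \<open>A section of a section is a section at a descendant of \<open>v\<close>;
        independence of the vertex brings it back to \<open>v\<close>.\<close>
      then have "word_section q f w \<in> group_sections q P (foldl child v w)"
        using word_section_tree_section[OF PB[OF x(1)] v w] by (auto simp: group_sections_def)
      then show ?thesis using indep[OF desc[OF w] v] by simp
    qed
    have tr: "transitive_on ?G {w \<in> ?W. length w = 1}"
      unfolding transitive_on_def
    proof (intro ballI)
      fix a b assume ab: "a \<in> {w \<in> ?W. length w = 1}" "b \<in> {w \<in> ?W. length w = 1}"
      then obtain x where "x \<in> P" "x (foldl child v a) = foldl child v b"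
        using triv[OF desc desc, of a b] by blast
      then show "\<exists>f\<in>?G. f a = b" using fix_v[of x a b] ab unfolding stab[OF v] by auto
    qed
    have "f \<in> (\<lambda>g. word_section q g w) ` vertex_stabiliser ?G w" if f: "f \<in> ?G" and w: "w \<in> ?W" for f w
    proof -
      \<comment> \<open>Regarding \<open>f\<close> as a section at the descendant given by
        \<open>w\<close> allows \<open>stab\<close> to supply an \<open>x\<close> fixing that
        vertex. This \<open>x\<close> also fixes \<open>v\<close>, and its section at
        \<open>v\<close> fixes \<open>w\<close> and has section \<open>f\<close> there.\<close>
      have "f \<in> group_sections q P (foldl child v w)" using indep[OF desc[OF w] v] f by simp
      then obtain x where x: "x \<in> P" "x (foldl child v w) = foldl child v w"
          "f = tree_section q x (foldl child v w)"
        unfolding stab[OF desc[OF w]] by (auto simp: vertex_stabiliser_def)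
      then have "tree_section q x v \<in> vertex_stabiliser ?G w"
        using fix_v[OF x(1) w w refl x(2)] by (auto simp: vertex_stabiliser_def group_sections_def)
      moreover have "f = word_section q (tree_section q x v) w"
        using word_section_tree_section[OF PB[OF x(1)] v w] x(3) by simp
      ultimately show ?thesis by blast
    qed
    then have "self_replicating q ?G"
      using Gsg ws tr unfolding self_replicating_def self_similar_def
      by (auto simp: vertex_stabiliser_def)
    then show ?thesis using 1 2 by blast
  qed
  show ?thesis using indep main by blast
qed

end
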